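(* Every finite tree $T$ satisfies $$|B(T)|\le\left\lceil \mathrm{DN}_{\mathrm{LLY}}(T)\right\rceil,$$ where $B(T):=\{v\in V(T): d_v\ge 3\}$ is the set of branch vertices of $T$.
   Context: Graphs are simple and undirected; $d_v$ is the degree of $v$. Let $d(\cdot,\cdot)$ be the combinatorial graph distance. For a positive edge weight $w:E\to(0,\infty)$ put $d_x^w:=\sum_{y\sim x}w_{xy}$. For $\alpha\in[0,1]$ let $\mu_x^{\alpha,w}$ be the probability measure with $\mu_x^{\alpha,w}(x)=\alpha$, $\mu_x^{\alpha,w}(z)=(1-\alpha)w_{xz}/d_x^w$ for $z\sim x$, and $0$ otherwise. Let $W_1$ be the $1$-Wasserstein distance with respect to $d$. For $x\sim y$ let $\kappa_\alpha^w(x,y):=1-W_1(\mu_x^{\alpha,w},\mu_y^{\alpha,w})$ and define the weighted Lin--Lu--Yau curvature $\kappa_{\mathrm{LLY}}^w(x,y):=\lim_{\alpha\to1^-}\kappa_\alpha^w(x,y)/(1-\alpha)$. For connected locally finite $G$ with $E\neq\varnothing$: $\mathrm{Dist}(w):=\sup_{e\in E}w_e/\inf_{e\in E}w_e$, with value $+\infty$ if the supremum is infinite or the infimum is $0$; a positive weight $w$ is admissible if $\kappa_{\mathrm{LLY}}^w(e)\ge0$ for every $e\in E$; and $\mathrm{DN}_{\mathrm{LLY}}(G):=\inf\{\mathrm{Dist}(w): w \text{ admissible}\}$, with value $+\infty$ if no admissible weight has finite distortion. By convention $\mathrm{DN}_{\mathrm{LLY}}(K_1)=1$. *)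

theory Defs
  imports "HOL-Probability.Probability"
begin

definition simple_graph :: "'a set \<Rightarrow> 'a set set \<Rightarrow> bool" where
  "simple_graph V E \<longleftrightarrow> (\<forall>e\<in>E. e \<subseteq> V \<and> card e = 2)"

definition nbrs :: "'a set set \<Rightarrow> 'a \<Rightarrow> 'a set" where
  "nbrs E x = {y. {x, y} \<in> E}"

definition vdegree :: "'a set set \<Rightarrow> 'a \<Rightarrow> nat" where
  "vdegree E x = card (nbrs E x)"

definition walk :: "'a set \<Rightarrow> 'a set set \<Rightarrow> 'a list \<Rightarrow> bool" where
  "walk V E p \<longleftrightarrow> p \<noteq> [] \<and> set p \<subseteq> V \<and> successively (\<lambda>u v. {u, v} \<in> E) p"

definition connected_graph :: "'a set \<Rightarrow> 'a set set \<Rightarrow> bool" where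
  "connected_graph V E \<longleftrightarrow>
     V \<noteq> {} \<and> (\<forall>x\<in>V. \<forall>y\<in>V. \<exists>p. walk V E p \<and> hd p = x \<and> last p = y)"

text \<open>A cycle is represented by the list of its distinct vertices, the closing edge joining
  the last one to the first.\<close>

definition graph_cycle :: "'a set \<Rightarrow> 'a set set \<Rightarrow> 'a list \<Rightarrow> bool" where
  "graph_cycle V E p \<longleftrightarrow> walk V E p \<and> distinct p \<and> length p \<ge> 3 \<and> {last p, hd p} \<in> E"

definition finite_tree :: "'a set \<Rightarrow> 'a set set \<Rightarrow> bool" where
  "finite_tree V E \<longleftrightarrow>
     finite V \<and> simple_graph V E \<and> connected_graph V E \<and> (\<nexists>p. graph_cycle V E p)"

definition branch_vertices :: "'a set \<Rightarrow> 'a set set \<Rightarrow> 'a set" where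
  "branch_vertices V E = {v \<in> V. vdegree E v \<ge> 3}"

text \<open>Only meaningful for vertices in a common component.\<close>

definition gdist :: "'a set \<Rightarrow> 'a set set \<Rightarrow> 'a \<Rightarrow> 'a \<Rightarrow> nat" where
  "gdist V E x y = (LEAST n. \<exists>p. walk V E p \<and> hd p = x \<and> last p = y \<and> length p = Suc n)"

definition wdeg :: "'a set set \<Rightarrow> ('a set \<Rightarrow> real) \<Rightarrow> 'a \<Rightarrow> real" where
  "wdeg E w x = (\<Sum>y\<in>nbrs E x. w {x, y})"

text \<open>The measure \<open>\<mu>\<^sub>x\<close> with idleness \<open>\<alpha>\<close>. The argument of \<open>embed_pmf\<close> is a probability mass
  function as soon as \<open>x\<close> has at least one and finitely many neighbours and \<open>\<alpha>\<close> lies in the unit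
  interval; see \<open>pmf_idle_pmf\<close> below.\<close>

definition idle_pmf :: "'a set set \<Rightarrow> ('a set \<Rightarrow> real) \<Rightarrow> real \<Rightarrow> 'a \<Rightarrow> 'a pmf" where
  "idle_pmf E w \<alpha> x = embed_pmf (\<lambda>z.
     if z = x then \<alpha>
     else if {x, z} \<in> E then (1 - \<alpha>) * w {x, z} / wdeg E w x
     else 0)"

lemma pmf_idle_pmf:
  assumes "simple_graph V E" "finite (nbrs E x)" "nbrs E x \<noteq> {}"
    and "\<And>e. e \<in> E \<Longrightarrow> w e > 0" "0 \<le> \<alpha>" "\<alpha> \<le> 1"
  shows "pmf (idle_pmf E w \<alpha> x) z =
    (if z = x then \<alpha> else if {x, z} \<in> E then (1 - \<alpha>) * w {x, z} / wdeg E w x else 0)"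
proof -
  define f where "f = (\<lambda>z. if z = x then \<alpha>
     else if {x, z} \<in> E then (1 - \<alpha>) * w {x, z} / wdeg E w x else 0)"
  have pos: "wdeg E w x > 0"
    unfolding wdeg_def using assms by (intro sum_pos) (auto simp: nbrs_def)
  have notin: "x \<notin> nbrs E x"
    using assms(1) by (fastforce simp: nbrs_def simple_graph_def)
  have nonneg: "f z \<ge> 0" for z
    using pos assms(4)[of "{x, z}"] assms(5,6) by (auto simp: f_def)
  have supp: "f z = 0" if "z \<notin> insert x (nbrs E x)" for z
    using that by (auto simp: f_def nbrs_def)
  have "sum f (insert x (nbrs E x)) = \<alpha> + (\<Sum>z\<in>nbrs E x. (1 - \<alpha>) * w {x, z} / wdeg E w x)"
    using notin assms(2) by (auto simp: f_def nbrs_def intro!: sum.cong)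
  also have "\<dots> = \<alpha> + (1 - \<alpha>) * wdeg E w x / wdeg E w x"
    by (simp only: wdeg_def sum_distrib_left sum_divide_distrib)
  also have "\<dots> = 1" using pos by simp
  finally have sum1: "sum f (insert x (nbrs E x)) = 1" .
  have "(\<integral>\<^sup>+ z. ennreal (f z) \<partial>count_space UNIV) = (\<Sum>z\<in>insert x (nbrs E x). ennreal (f z))"
    using supp assms(2) by (intro nn_integral_count_space'[of "insert x (nbrs E x)"]) auto
  also have "\<dots> = 1" using sum1 nonneg by (simp del: sum.insert add: sum_ennreal)
  finally have "pmf (embed_pmf f) z = f z" by (intro pmf_embed_pmf nonneg)
  then show ?thesis by (simp add: f_def idle_pmf_def)
qed

text \<open>The \<open>1\<close>-Wasserstein distance as an infimum over couplings. It is used for finitely supported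
  measures only, where every coupling is finitely supported and has an integrable cost.\<close>

definition couplings :: "'a pmf \<Rightarrow> 'a pmf \<Rightarrow> ('a \<times> 'a) pmf set" where
  "couplings \<mu> \<nu> = {\<pi>. map_pmf fst \<pi> = \<mu> \<and> map_pmf snd \<pi> = \<nu>}"

definition wasserstein1 :: "('a \<Rightarrow> 'a \<Rightarrow> real) \<Rightarrow> 'a pmf \<Rightarrow> 'a pmf \<Rightarrow> real" where
  "wasserstein1 d \<mu> \<nu> = (INF \<pi>\<in>couplings \<mu> \<nu>. measure_pmf.expectation \<pi> (\<lambda>(x, y). d x y))"

definition kappa :: "'a set \<Rightarrow> 'a set set \<Rightarrow> ('a set \<Rightarrow> real) \<Rightarrow> real \<Rightarrow> 'a \<Rightarrow> 'a \<Rightarrow> real" where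
  "kappa V E w \<alpha> x y =
     1 - wasserstein1 (\<lambda>u v. real (gdist V E u v)) (idle_pmf E w \<alpha> x) (idle_pmf E w \<alpha> y)"

definition kappa_LLY :: "'a set \<Rightarrow> 'a set set \<Rightarrow> ('a set \<Rightarrow> real) \<Rightarrow> 'a \<Rightarrow> 'a \<Rightarrow> real" where
  "kappa_LLY V E w x y = Lim (at_left 1) (\<lambda>\<alpha>. kappa V E w \<alpha> x y / (1 - \<alpha>))"

definition Dist :: "'a set set \<Rightarrow> ('a set \<Rightarrow> real) \<Rightarrow> ereal" where
  "Dist E w =
     (let s = (SUP e\<in>E. ereal (w e)); i = (INF e\<in>E. ereal (w e))
      in if s = \<infinity> \<or> i = 0 then \<infinity> else s / i)"

definition admissible :: "'a set \<Rightarrow> 'a set set \<Rightarrow> ('a set \<Rightarrow> real) \<Rightarrow> bool" where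
  "admissible V E w \<longleftrightarrow>
     (\<forall>e\<in>E. w e > 0) \<and> (\<forall>x y. {x, y} \<in> E \<longrightarrow> kappa_LLY V E w x y \<ge> 0)"

text \<open>The infimum of the empty set is \<open>\<infinity>\<close> in \<^typ>\<open>ereal\<close>; the first case is the convention for
  \<open>K\<^sub>1\<close>.\<close>

definition DN_LLY :: "'a set \<Rightarrow> 'a set set \<Rightarrow> ereal" where
  "DN_LLY V E = (if card V = 1 then 1 else (INF w\<in>{w. admissible V E w}. Dist E w))"

definition ereal_ceiling :: "ereal \<Rightarrow> ereal" where
  "ereal_ceiling x = (if \<bar>x\<bar> = \<infinity> then x else ereal (real_of_int \<lceil>real_of_ereal x\<rceil>))"

end

(* On a tree the LLY curvature of an edge xy is 2 (w/d_x + w/d_y - 1), so that admissibility means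
   w^2 >= (d_x - w) (d_y - w) on every edge. Hence, going away from an edge of maximal weight, the
   total weight S of the edges following an edge never exceeds the weight of that edge, except
   possibly at one end of the maximal edge itself. At a branch vertex the inequality loses at
   least 2 m, with m the minimal weight, so S >= 2 m b where b counts the branch vertices further
   out. Comparing both sides of the maximal edge gives Dist w >= |B| - 3/4 for every admissible w,
   and rounding up removes the error. *)

theory Submission
  imports Defs
begin

text \<open>The curvature inequality bounds only a product of two sums, so it controls the outward
  sum only where the inward one is known to be large. Once S \<le> w holds on an edge, it passes to
  every edge that follows: for a following edge of weight u the inward sum is w + S - u \<ge> 2 S -
  u \<ge> u, which forces the outward sum to be at most u. An edge of maximal weight starts this.
  With its weight normalised to 1, the product of its two sums is at most 1, so at most one of them
  exceeds 1.

  That heavy side is the obstacle. The count fails for the maximal edge in this direction and has to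
  restart at the edges leaving the heavy end, which itself then goes unpaid. Bounding the total by 2
  would give only |B| - 1, one too small after rounding up. Improving 2 to 1 + 1 / (1 + m) \<le> 2 -
  m / 2 recovers a quarter of a vertex, hence the constant 3/4.\<close>

section \<open>Counting branch vertices by edge weights\<close>

text \<open>For an edge xy this is \<open>wdeg E w y - w {x, y}\<close>, the S of the overview. The
  arguments are ordered: x is the parent, y the end further out.\<close>

definition other_weight :: "'a set set \<Rightarrow> ('a set \<Rightarrow> real) \<Rightarrow> 'a \<Rightarrow> 'a \<Rightarrow> real" where
  "other_weight E w x y = (\<Sum>z\<in>nbrs E y - {x}. w {y, z})"

text \<open>The parameter \<open>k\<close> bounds the depth: \<open>beyond E k x y\<close> consists of the vertices reached from
  \<open>y\<close> by non-backtracking walks on fewer than \<open>k\<close> edges whose first step is not back to \<open>x\<close>.\<close>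

fun beyond :: "'a set set \<Rightarrow> nat \<Rightarrow> 'a \<Rightarrow> 'a \<Rightarrow> 'a set" where
  "beyond E 0 x y = {}"
| "beyond E (Suc k) x y = insert y (\<Union>z\<in>nbrs E y - {x}. beyond E k y z)"

lemma other_weight_nonneg:
  assumes "\<And>e. e \<in> E \<Longrightarrow> 0 \<le> w e"
  shows "0 \<le> other_weight E w x y"
  unfolding other_weight_def using assms by (intro sum_nonneg) (auto simp: nbrs_def)

lemma wdeg_split:
  assumes "finite (nbrs E y)" "{x, y} \<in> E"
  shows "wdeg E w y = w {x, y} + other_weight E w x y"
proof -
  have "x \<in> nbrs E y" using assms(2) by (simp add: nbrs_def insert_commute)
  then show ?thesis unfolding wdeg_def other_weight_def using assms(1)
    by (simp add: sum.remove insert_commute)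
qed

text \<open>Both sides are \<open>wdeg E w y - w {y, z}\<close>. This is the inward factor in the
  curvature inequality of the edge yz, expressed through data of the parent edge xy.\<close>

lemma other_weight_child:
  assumes "finite (nbrs E y)" "{x, y} \<in> E" "z \<in> nbrs E y"
  shows "other_weight E w z y = w {x, y} + other_weight E w x y - w {y, z}"
  using wdeg_split[OF assms(1,2), of w] wdeg_split[OF assms(1), of z w] assms(3)
  by (simp add: nbrs_def insert_commute)

lemma card_beyond_Suc:
  assumes fin: "\<And>v. finite (nbrs E v)"
  shows "card (B \<inter> beyond E (Suc k) x y)
    \<le> (if y \<in> B then 1 else 0) + (\<Sum>z\<in>nbrs E y - {x}. card (B \<inter> beyond E k y z))"
proof -
  let ?U = "\<Union>z\<in>nbrs E y - {x}. B \<inter> beyond E k y z"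
  have "B \<inter> beyond E (Suc k) x y = (if y \<in> B then {y} else {}) \<union> ?U"
    by auto
  then have "card (B \<inter> beyond E (Suc k) x y) \<le> card (if y \<in> B then {y} else {}) + card ?U"
    by (simp only: card_Un_le)
  also have "card ?U \<le> (\<Sum>z\<in>nbrs E y - {x}. card (B \<inter> beyond E k y z))"
    using fin by (intro card_UN_le) auto
  finally show ?thesis by (auto split: if_splits)
qed

lemma card_children_ge_2:
  assumes "finite (nbrs E y)" "vdegree E y \<ge> 3"
  shows "card (nbrs E y - {x}) \<ge> 2"
  using assms card_Diff_singleton_if[of "nbrs E y" x] unfolding vdegree_def by (auto split: if_splits)

text \<open>A sibling of z remains in the sum after z is removed, and its edge alone weighs at least
  m.\<close>

lemma le_other_weight_minus_child:
  assumes "finite (nbrs E y)" "card (nbrs E y - {x}) \<ge> 2" "z \<in> nbrs E y - {x}"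
    and m: "\<And>e. e \<in> E \<Longrightarrow> m \<le> w e" and "0 \<le> m"
  shows "m \<le> other_weight E w x y - w {y, z}"
proof -
  have "card (nbrs E y - {x} - {z}) \<noteq> 0"
    using assms(1-3) by (simp add: card_Diff_singleton_if)
  then obtain z' where z': "z' \<in> nbrs E y - {x} - {z}" by (metis card.empty ex_in_conv)
  have "m \<le> w {y, z'}" using z' m by (auto simp: nbrs_def)
  also have "\<dots> \<le> (\<Sum>z\<in>nbrs E y - {x} - {z}. w {y, z})"
  proof (rule member_le_sum[OF z'])
    fix v assume "v \<in> nbrs E y - {x} - {z} - {z'}"
    then have "m \<le> w {y, v}" by (intro m) (auto simp: nbrs_def)
    then show "0 \<le> w {y, v}" using assms(5) by linarith
  qed (use assms(1) in auto)
  also have "\<dots> = other_weight E w x y - w {y, z}"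
    unfolding other_weight_def using assms(1,3) by (subst (2) sum.remove[of _ z]) auto
  finally show ?thesis .
qed

text \<open>The hypothesis \<open>curv\<close> is nonnegative curvature of a tree edge: cleared of denominators,
  \<open>w / d\<^sub>x + w / d\<^sub>y \<ge> 1\<close> says \<open>w\<^sup>2 \<ge> (d\<^sub>x - w) (d\<^sub>y - w)\<close>.\<close>

lemma branch_count_le_other_weight:
  fixes w :: "'a set \<Rightarrow> real"
  assumes fin: "\<And>v. finite (nbrs E v)" and "0 < m" and m: "\<And>e. e \<in> E \<Longrightarrow> m \<le> w e"
    and curv: "\<And>x y. {x, y} \<in> E \<Longrightarrow> other_weight E w x y * other_weight E w y x \<le> (w {x, y})\<^sup>2"
    and B: "\<And>v. v \<in> B \<Longrightarrow> vdegree E v \<ge> 3"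
    and "{x, y} \<in> E" "other_weight E w x y \<le> w {x, y}"
  shows "2 * m * card (B \<inter> beyond E k x y) \<le> other_weight E w x y"
  using assms(6,7)
proof (induction k arbitrary: x y)
  case 0
  have "0 \<le> w e" if "e \<in> E" for e using m[OF that] \<open>0 < m\<close> by linarith
  then show ?case by (simp add: other_weight_nonneg)
next
  case (Suc k)
  define C where "C = nbrs E y - {x}"
  define s where "s = other_weight E w x y"
  define W where "W = w {x, y}"
  define \<beta> where "\<beta> z = real (card (B \<inter> beyond E k y z))" for z
  have s_sum: "s = (\<Sum>z\<in>C. w {y, z})" by (simp add: s_def C_def other_weight_def)
  have finC: "finite C" using fin by (simp add: C_def)
  have w0: "0 \<le> w e" if "e \<in> E" for e using m[OF that] \<open>0 < m\<close> by linarith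
  have CE: "{y, z} \<in> E" if "z \<in> C" for z using that by (simp add: C_def nbrs_def)
  have child: "2 * m * \<beta> z \<le> other_weight E w y z \<and> other_weight E w y z \<le> w {y, z}
     \<and> other_weight E w y z * (2 * s - w {y, z}) \<le> (w {y, z})\<^sup>2" if z: "z \<in> C" for z
  proof -
    define u where "u = w {y, z}"
    define t where "t = other_weight E w y z"
    have u: "m \<le> u" unfolding u_def using m CE z by blast
    have "u \<le> s" unfolding u_def s_sum using z finC w0 CE by (intro member_le_sum) auto
    have t0: "0 \<le> t" unfolding t_def by (intro other_weight_nonneg w0)
    have "s \<le> W" using Suc.prems(2) by (simp add: s_def W_def)
    have "t * (W + s - u) \<le> u\<^sup>2"
      using curv[OF CE[OF z]] other_weight_child[OF fin Suc.prems(1), of z w] z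
      by (simp add: C_def t_def u_def W_def s_def)
    \<comment> \<open>The hypothesis s \<le> W enters here. Lowering W to s leaves a factor that is
      still at least u, so t \<le> u follows and the induction hypothesis applies to the
      child.\<close>
    moreover have "t * (2 * s - u) \<le> t * (W + s - u)"
      using t0 \<open>s \<le> W\<close> by (intro mult_left_mono) auto
    ultimately have 2: "t * (2 * s - u) \<le> u\<^sup>2" by linarith
    have "t * u \<le> t * (2 * s - u)" using t0 \<open>u \<le> s\<close> by (intro mult_left_mono) auto
    with 2 have "t * u \<le> u * u" by (simp add: power2_eq_square)
    then have "t \<le> u" using u \<open>0 < m\<close> by simp
    then show ?thesis
      using Suc.IH[OF CE[OF z]] 2 by (simp add: \<beta>_def t_def u_def)
  qed
  have sumC: "(\<Sum>z\<in>C. 2 * m * \<beta> z) = 2 * m * (\<Sum>z\<in>C. \<beta> z)" by (simp add: sum_distrib_left)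
  have card: "real (card (B \<inter> beyond E (Suc k) x y)) \<le> (if y \<in> B then 1 else 0) + (\<Sum>z\<in>C. \<beta> z)"
    using card_beyond_Suc[OF fin, of B k x y]
    unfolding \<beta>_def C_def of_nat_sum[symmetric] by (simp split: if_splits del: beyond.simps of_nat_sum)
  have "2 * m * (if y \<in> B then 1 else 0) + (\<Sum>z\<in>C. 2 * m * \<beta> z) \<le> s"
  proof (cases "y \<in> B")
    case True
    then have C2: "card C \<ge> 2" unfolding C_def using card_children_ge_2[OF fin] B by blast
    \<comment> \<open>Each child edge keeps m in reserve beyond what its own branch vertices cost;
      at least two children together pay the 2 m for y.\<close>
    have "m + 2 * m * \<beta> z \<le> w {y, z}" if z: "z \<in> C" for z
    proof (cases "\<beta> z = 0")
      case True
      then show ?thesis using m[OF CE[OF z]] by simp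
    next
      case False
      then have "\<beta> z \<ge> 1" by (simp add: \<beta>_def)
      then have "2 * m \<le> 2 * m * \<beta> z" using \<open>0 < m\<close> by simp
      define u where "u = w {y, z}"
      define t where "t = other_weight E w y z"
      have ch: "2 * m * \<beta> z \<le> t" "t \<le> u" "t * (2 * s - u) \<le> u\<^sup>2"
        using child[OF z] by (simp_all add: t_def u_def)
      have "2 * m \<le> u" using ch \<open>2 * m \<le> 2 * m * \<beta> z\<close> by linarith
      have r: "m \<le> s - u"
        unfolding s_def u_def using C2 z m \<open>0 < m\<close> fin unfolding C_def
        by (intro le_other_weight_minus_child) auto
      \<comment> \<open>The sibling weight raises the inward factor to at least u + 2 m, and (u - m)
        (u + 2 m) \<ge> u^2 holds exactly when u \<ge> 2 m. The latter is known because a branch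
        vertex beyond z already forces t \<ge> 2 m.\<close>
      have "t \<le> u - m"
      proof (rule ccontr)
        assume "\<not> t \<le> u - m"
        have "(u - m) * (u + 2 * m) \<le> (u - m) * (2 * s - u)"
          using r \<open>2 * m \<le> u\<close> \<open>0 < m\<close> by (intro mult_left_mono) auto
        also have "\<dots> < t * (2 * s - u)"
          using r \<open>2 * m \<le> u\<close> \<open>0 < m\<close> \<open>\<not> t \<le> u - m\<close> by (intro mult_strict_right_mono) auto
        also have "\<dots> \<le> u\<^sup>2" by (rule ch)
        finally have "m * u < m * (2 * m)" by (simp add: algebra_simps power2_eq_square)
        with \<open>0 < m\<close> \<open>2 * m \<le> u\<close> show False by simp
      qed
      with ch show ?thesis by (simp add: u_def)
    qed
    then have "(\<Sum>z\<in>C. m + 2 * m * \<beta> z) \<le> s" unfolding s_sum by (rule sum_mono)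
    moreover have "2 * m \<le> card C * m" using C2 \<open>0 < m\<close> by simp
    ultimately show ?thesis using True by (simp add: sum.distrib)
  next
    case False
    have "(\<Sum>z\<in>C. 2 * m * \<beta> z) \<le> s"
      unfolding s_sum using child by (intro sum_mono) (meson order_trans)
    then show ?thesis using False by simp
  qed
  moreover have "2 * m * real (card (B \<inter> beyond E (Suc k) x y))
     \<le> 2 * m * ((if y \<in> B then 1 else 0) + (\<Sum>z\<in>C. \<beta> z))"
    using card \<open>0 < m\<close> by (intro mult_left_mono) auto
  ultimately show ?case unfolding sumC s_def[symmetric] by (simp only: distrib_left)
qed

text \<open>Both sides of the maximal edge contribute \<open>1\<close> to \<open>2 m |B|\<close> if neither has other weight above
  \<open>1\<close>. Otherwise the heavier end \<open>y\<close> is a branch vertex and one counts around \<open>y\<close>, which is not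
  itself charged. The slack \<open>1 / 4\<close> is what keeps the infimum over all weights above \<open>|B| - 1\<close>.\<close>

lemma branch_count_max_edge_aux:
  fixes w :: "'a set \<Rightarrow> real"
  assumes fin: "\<And>v. finite (nbrs E v)" and "0 < m" and m: "\<And>e. e \<in> E \<Longrightarrow> m \<le> w e"
    and max: "\<And>e. e \<in> E \<Longrightarrow> w e \<le> 1"
    and curv: "\<And>x y. {x, y} \<in> E \<Longrightarrow> other_weight E w x y * other_weight E w y x \<le> (w {x, y})\<^sup>2"
    and B: "\<And>v. v \<in> B \<Longrightarrow> vdegree E v \<ge> 3"
    and xy: "{x, y} \<in> E" "w {x, y} = 1"
    and le: "other_weight E w y x \<le> other_weight E w x y"
  shows "(card (B \<inter> beyond E k x y) + card (B \<inter> beyond E k y x) - 3 / 4) * m \<le> 1"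
proof -
  note count = branch_count_le_other_weight[OF fin \<open>0 < m\<close> m curv B]
  define P where "P = other_weight E w y x"
  define Q where "Q = other_weight E w x y"
  define b where "b = real (card (B \<inter> beyond E k x y))"
  define b' where "b' = real (card (B \<inter> beyond E k y x))"
  have w0: "0 \<le> w e" if "e \<in> E" for e using m[OF that] \<open>0 < m\<close> by linarith
  have yx: "{y, x} \<in> E" "w {y, x} = 1" using xy by (simp_all add: insert_commute)
  have m1: "m \<le> 1" using m[OF xy(1)] xy(2) by simp
  have PQ: "Q * P \<le> 1" using curv[OF xy(1)] xy(2) by (simp add: P_def Q_def)
  have "P \<le> 1"
  proof (rule ccontr)
    assume "\<not> P \<le> 1"
    then have "1 < P" "1 < Q" using le by (simp_all add: P_def Q_def)
    then have "1 < Q * P" by (simp add: less_1_mult)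
    with PQ show False by simp
  qed
  then have b': "2 * m * b' \<le> P"
    using count[where x = y and y = x and k = k] yx by (simp add: P_def b'_def)
  show ?thesis
  proof (cases "Q \<le> 1")
    case True
    then have "2 * m * b \<le> Q" using count[where x = x and y = y and k = k] xy by (simp add: Q_def b_def)
    then have "(b + b') * m \<le> 1" using b' True \<open>P \<le> 1\<close> by (simp add: algebra_simps)
    then show ?thesis using \<open>0 < m\<close> by (simp add: b_def b'_def algebra_simps)
  next
    case False
    define C where "C = nbrs E y - {x}"
    \<comment> \<open>One level of depth is spent on reaching y. For k = 0 the subtraction
      truncates, which is harmless since then b = 0.\<close>
    define \<beta> where "\<beta> z = real (card (B \<inter> beyond E (k - 1) y z))" for z
    define u where "u z = w {y, z}" for z
    define t where "t z = other_weight E w y z" for z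
    have Q_sum: "Q = (\<Sum>z\<in>C. u z)" by (simp add: Q_def u_def C_def other_weight_def)
    have finC: "finite C" using fin by (simp add: C_def)
    have CE: "{y, z} \<in> E" if "z \<in> C" for z using that by (simp add: C_def nbrs_def)
    have "Q \<le> real (card C) * 1" unfolding Q_sum by (rule sum_bounded_above) (auto simp: u_def intro: max CE)
    then have C2: "card C \<ge> 2" using False by simp
    \<comment> \<open>The inward factor 1 + Q - u is at least Q because u \<le> 1, and at least 1 +
      m because a sibling gives u \<le> Q - m. The first bound also yields t \<le> u, the hypothesis
      under which the count applies to the edge yz.\<close>
    have "2 * m * \<beta> z \<le> t z \<and> t z \<le> u z / Q \<and> t z * (1 + m) \<le> u z * (Q - m)" if z: "z \<in> C" for z
    proof -
      have u: "m \<le> u z" "u z \<le> 1" unfolding u_def using m max CE z by auto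
      have t0: "0 \<le> t z" unfolding t_def by (intro other_weight_nonneg w0)
      have r: "m \<le> Q - u z"
        unfolding Q_def u_def using C2 z m \<open>0 < m\<close> fin unfolding C_def
        by (intro le_other_weight_minus_child) auto
      have tu: "t z * (1 + Q - u z) \<le> u z * u z"
        using curv[OF CE[OF z]] other_weight_child[OF fin xy(1), of z w] z xy(2)
        by (simp add: C_def t_def u_def Q_def power2_eq_square)
      have "t z * Q \<le> t z * (1 + Q - u z)" using t0 u by (intro mult_left_mono) auto
      also have "\<dots> \<le> u z * 1" using tu u \<open>0 < m\<close> mult_left_mono[of "u z" 1 "u z"] by linarith
      finally have 1: "t z \<le> u z / Q" using False by (simp add: field_simps)
      also have "\<dots> \<le> u z / 1" using False u \<open>0 < m\<close> by (intro divide_left_mono) auto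
      finally have "2 * m * \<beta> z \<le> t z"
        using count[where x = y and y = z and k = "k - 1"] CE[OF z] by (simp add: \<beta>_def t_def u_def)
      moreover have "t z * (1 + m) \<le> t z * (1 + Q - u z)"
        using t0 r by (intro mult_left_mono) auto
      moreover have "u z * u z \<le> u z * (Q - m)" using u r \<open>0 < m\<close> by (intro mult_left_mono) auto
      ultimately show ?thesis using 1 tu by linarith
    qed
    then have t: "2 * m * \<beta> z \<le> t z" "t z \<le> u z / Q" "t z \<le> u z * (Q - m) / (1 + m)" if "z \<in> C" for z
      using that \<open>0 < m\<close> by (auto simp: field_simps)
    have "2 * m * (\<Sum>z\<in>C. \<beta> z) \<le> (\<Sum>z\<in>C. t z)"
      unfolding sum_distrib_left using t by (intro sum_mono)
    moreover have "b \<le> 1 + (\<Sum>z\<in>C. \<beta> z)"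
    proof (cases k)
      case 0
      then show ?thesis by (simp add: b_def \<beta>_def sum_nonneg)
    next
      case (Suc j)
      then show ?thesis using card_beyond_Suc[OF fin, of B j x y]
        unfolding b_def \<beta>_def C_def of_nat_sum[symmetric]
        by (simp split: if_splits del: beyond.simps of_nat_sum)
    qed
    then have "2 * m * b \<le> 2 * m * (1 + (\<Sum>z\<in>C. \<beta> z))"
      using \<open>0 < m\<close> by (intro mult_left_mono) auto
    ultimately have main: "2 * m * (b + b' - 1) \<le> P + (\<Sum>z\<in>C. t z)"
      using b' by (simp add: algebra_simps)
    have P: "P \<le> 1 / Q" using PQ False by (simp add: field_simps)
    have "P + (\<Sum>z\<in>C. t z) \<le> 1 + 1 / (1 + m)"
    \<comment> \<open>Summed over the children, the two bounds on t are 1 and Q (Q - m) / (1 + m);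
      they agree at Q = 1 + m.\<close>
    proof (cases "1 + m \<le> Q")
      case True
      have "(\<Sum>z\<in>C. t z) \<le> (\<Sum>z\<in>C. u z / Q)" using t by (intro sum_mono)
      also have "\<dots> = 1" using False by (simp add: Q_sum[symmetric] sum_divide_distrib[symmetric])
      moreover have "1 / Q \<le> 1 / (1 + m)" using True \<open>0 < m\<close> by (intro divide_left_mono) auto
      ultimately show ?thesis using P by linarith
    next
      case Qm: False
      have "(\<Sum>z\<in>C. t z) \<le> (\<Sum>z\<in>C. u z * (Q - m) / (1 + m))" using t by (intro sum_mono)
      also have "\<dots> = Q * (Q - m) / (1 + m)"
        by (simp only: Q_sum[symmetric] sum_divide_distrib[symmetric] sum_distrib_right[symmetric])
      finally have sum_t: "(\<Sum>z\<in>C. t z) \<le> Q * (Q - m) / (1 + m)" .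
      have "1 \<le> Q\<^sup>2 + Q" using False by (simp add: add_increasing power2_eq_square)
      \<comment> \<open>This is the inequality 1 / Q + Q (Q - m) / (1 + m) \<le> 1 + 1 / (1 + m)
        multiplied by Q (1 + m). Equality at Q = 1 + m supplies the linear factor.\<close>
      then have "(Q - 1 - m) * (Q\<^sup>2 + Q - 1) \<le> 0" using Qm by (intro mult_nonpos_nonneg) auto
      then have "(1 + m) + Q * (Q * (Q - m)) \<le> Q * (2 + m)"
        by (simp add: algebra_simps power2_eq_square)
      then have "((1 + m) + Q * (Q * (Q - m))) / (Q * (1 + m)) \<le> Q * (2 + m) / (Q * (1 + m))"
        using False \<open>0 < m\<close> by (intro divide_right_mono) auto
      moreover have "((1 + m) + Q * (Q * (Q - m))) / (Q * (1 + m)) = 1 / Q + Q * (Q - m) / (1 + m)"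
        using False \<open>0 < m\<close> by (subst add_divide_distrib) simp
      moreover have "Q * (2 + m) / (Q * (1 + m)) = 1 + 1 / (1 + m)"
        using False \<open>0 < m\<close> by (simp add: add_divide_eq_iff)
      ultimately show ?thesis using P sum_t by linarith
    qed
    moreover have "1 / (1 + m) \<le> 1 - m / 2"
    proof -
      have "m * m \<le> m * 1" using m1 \<open>0 < m\<close> by (intro mult_left_mono) auto
      then show ?thesis using \<open>0 < m\<close> by (simp add: field_simps)
    qed
    ultimately have "2 * m * (b + b' - 1) \<le> 2 - m / 2" using main by linarith
    then show ?thesis by (simp add: b_def b'_def algebra_simps)
  qed
qed

text \<open>The curvature inequality is homogeneous of degree two, so dividing by M preserves it;
  exchanging x and y settles which end is the heavier one.\<close>

lemma branch_count_max_edge: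
  fixes w :: "'a set \<Rightarrow> real"
  assumes fin: "\<And>v. finite (nbrs E v)" and "0 < m" and m: "\<And>e. e \<in> E \<Longrightarrow> m \<le> w e"
    and max: "\<And>e. e \<in> E \<Longrightarrow> w e \<le> M"
    and curv: "\<And>x y. {x, y} \<in> E \<Longrightarrow> other_weight E w x y * other_weight E w y x \<le> (w {x, y})\<^sup>2"
    and B: "\<And>v. v \<in> B \<Longrightarrow> vdegree E v \<ge> 3"
    and xy: "{x, y} \<in> E" "w {x, y} = M"
    and cover: "B \<subseteq> beyond E k x y \<union> beyond E k y x"
  shows "card B - 3 / 4 \<le> M / m"
proof -
  have "0 < M" using m[OF xy(1)] xy(2) \<open>0 < m\<close> by linarith
  define w' where "w' e = w e / M" for e
  have ow: "other_weight E w' p q = other_weight E w p q / M" for p q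
    by (simp add: other_weight_def w'_def sum_divide_distrib)
  have curv': "other_weight E w' p q * other_weight E w' q p \<le> (w' {p, q})\<^sup>2" if "{p, q} \<in> E" for p q
    using curv[OF that] \<open>0 < M\<close> by (simp add: ow w'_def power2_eq_square divide_right_mono)
  note aux = branch_count_max_edge_aux[where E = E and w = w' and m = "m / M" and B = B and k = k,
      OF fin _ _ _ curv' B]
  have "(card (B \<inter> beyond E k x y) + card (B \<inter> beyond E k y x) - 3 / 4) * (m / M) \<le> 1"
  proof (cases "other_weight E w' y x \<le> other_weight E w' x y")
    case True
    then show ?thesis
      using xy \<open>0 < M\<close> \<open>0 < m\<close> m max
      by (intro aux) (auto simp: w'_def divide_right_mono)
  next
    case False
    then have "(card (B \<inter> beyond E k y x) + card (B \<inter> beyond E k x y) - 3 / 4) * (m / M) \<le> 1"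
      using xy \<open>0 < M\<close> \<open>0 < m\<close> m max
      by (intro aux) (auto simp: w'_def divide_right_mono insert_commute)
    then show ?thesis by (simp add: add.commute)
  qed
  then have "card (B \<inter> beyond E k x y) + card (B \<inter> beyond E k y x) - 3 / 4 \<le> M / m"
    using \<open>0 < M\<close> \<open>0 < m\<close> by (simp add: field_simps)
  moreover have "B = (B \<inter> beyond E k x y) \<union> (B \<inter> beyond E k y x)" using cover by blast
  then have "card B \<le> card (B \<inter> beyond E k x y) + card (B \<inter> beyond E k y x)"
    by (metis card_Un_le)
  ultimately show ?thesis by linarith
qed

section \<open>Covering all vertices from the two sides of one edge\<close>

lemma beyond_mono: "k \<le> l \<Longrightarrow> beyond E k x y \<subseteq> beyond E l x y"
proof (induction k arbitrary: l x y)
  case (Suc k)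
  then obtain l' where "l = Suc l'" "k \<le> l'" by (metis Suc_le_D Suc_le_mono)
  with Suc.IH[of l'] show ?case by fastforce
qed simp

lemma beyond_step:
  "v \<in> beyond E k x y \<Longrightarrow> {v, v'} \<in> E \<Longrightarrow> v' = x \<or> v' \<in> beyond E (Suc k) x y"
proof (induction k arbitrary: x y)
  case (Suc k)
  show ?case
  proof (cases "v = y")
    case True
    with Suc.prems show ?thesis by (auto simp: nbrs_def)
  next
    case False
    with Suc.prems(1) obtain z where z: "z \<in> nbrs E y - {x}" "v \<in> beyond E k y z" by auto
    with Suc.IH Suc.prems(2) have "v' = y \<or> v' \<in> beyond E (Suc k) y z" by blast
    with z(1) show ?thesis by (subst beyond.simps) blast
  qed
qed simp

text \<open>By \<open>beyond_step\<close> a walk can leave one side only by arriving at the root of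
  the other side; every step costs one level of depth.\<close>

lemma walk_end_beyond:
  assumes "walk V E p" "hd p = x"
  shows "last p \<in> beyond E (length p) x y \<union> beyond E (length p) y x"
  using assms
proof (induction p rule: rev_induct)
  case (snoc v p)
  show ?case
  proof (cases "p = []")
    case True
    with snoc.prems show ?thesis by simp
  next
    case False
    with snoc.prems have "walk V E p" "hd p = x" "{last p, v} \<in> E"
      by (auto simp: walk_def successively_append_iff)
    with snoc.IH beyond_step[of "last p" E "length p" _ _ v]
    show ?thesis by (simp del: beyond.simps) (auto simp: nbrs_def)
  qed
qed (simp add: walk_def)

lemma connected_cover:
  assumes "finite V" "connected_graph V E" "x \<in> V"
  shows "\<exists>k. V \<subseteq> beyond E k x y \<union> beyond E k y x"
proof -
  have "\<exists>k. v \<in> beyond E k x y \<union> beyond E k y x" if "v \<in> V" for v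
    using assms(2,3) that walk_end_beyond unfolding connected_graph_def by metis
  then obtain \<kappa> where \<kappa>: "v \<in> beyond E (\<kappa> v) x y \<union> beyond E (\<kappa> v) y x" if "v \<in> V" for v
    by metis
  \<comment> \<open>The sum serves as a common upper bound of the finitely many depths.\<close>
  have "v \<in> beyond E (sum \<kappa> V) x y \<union> beyond E (sum \<kappa> V) y x" if "v \<in> V" for v
  proof -
    have le: "\<kappa> v \<le> sum \<kappa> V" using assms(1) that by (intro member_le_sum) auto
    then show ?thesis using \<kappa>[OF that] beyond_mono[OF le, of E x y] beyond_mono[OF le, of E y x] by blast
  qed
  then show ?thesis by blast
qed


section \<open>Wasserstein distance of finitely supported measures\<close>

lemma set_pmf_coupling_subset:
  assumes "\<pi> \<in> couplings \<mu> \<nu>"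
  shows "set_pmf \<pi> \<subseteq> set_pmf \<mu> \<times> set_pmf \<nu>"
  using assms by (force simp: couplings_def)

text \<open>The easy half of Kantorovich duality: f q - f p has the same expectation under every
  coupling, bounds the cost from below, and equals it on \<pi>. The Lipschitz bound is asked for on
  the supports only, so f may be arbitrary elsewhere.\<close>

lemma wasserstein1_eqI:
  fixes \<mu> \<nu> :: "'a pmf" and f :: "'a \<Rightarrow> real"
  assumes fin: "finite (set_pmf \<mu>)" "finite (set_pmf \<nu>)"
    and lip: "\<And>p q. p \<in> set_pmf \<mu> \<Longrightarrow> q \<in> set_pmf \<nu> \<Longrightarrow> f q - f p \<le> d p q"
    and \<pi>: "\<pi> \<in> couplings \<mu> \<nu>"
    and tight: "\<And>p q. (p, q) \<in> set_pmf \<pi> \<Longrightarrow> d p q = f q - f p"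
  shows "wasserstein1 d \<mu> \<nu> = measure_pmf.expectation \<nu> f - measure_pmf.expectation \<mu> f"
proof -
  have finc: "finite (set_pmf \<rho>)" if "\<rho> \<in> couplings \<mu> \<nu>" for \<rho>
    using set_pmf_coupling_subset[OF that] fin by (meson finite_SigmaI finite_subset)
  have pot: "measure_pmf.expectation \<rho> (\<lambda>(p, q). f q - f p)
      = measure_pmf.expectation \<nu> f - measure_pmf.expectation \<mu> f" if \<rho>: "\<rho> \<in> couplings \<mu> \<nu>" for \<rho>
  proof -
    have "measure_pmf.expectation \<rho> (\<lambda>(p, q). f q - f p)
       = measure_pmf.expectation \<rho> (\<lambda>z. f (snd z)) - measure_pmf.expectation \<rho> (\<lambda>z. f (fst z))"
      unfolding case_prod_beta
      by (intro Bochner_Integration.integral_diff integrable_measure_pmf_finite finc[OF \<rho>])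
    also have "\<dots> = measure_pmf.expectation (map_pmf snd \<rho>) f - measure_pmf.expectation (map_pmf fst \<rho>) f"
      by simp
    finally show ?thesis using \<rho> by (simp only: couplings_def mem_Collect_eq)
  qed
  have "measure_pmf.expectation \<pi> (\<lambda>(p, q). d p q) = measure_pmf.expectation \<pi> (\<lambda>(p, q). f q - f p)"
    using tight by (intro integral_cong_AE) (auto simp: AE_measure_pmf_iff)
  then have min: "measure_pmf.expectation \<pi> (\<lambda>(p, q). d p q)
      = measure_pmf.expectation \<nu> f - measure_pmf.expectation \<mu> f"
    using pot[OF \<pi>] by simp
  have "measure_pmf.expectation \<nu> f - measure_pmf.expectation \<mu> f
      \<le> measure_pmf.expectation \<rho> (\<lambda>(p, q). d p q)" if \<rho>: "\<rho> \<in> couplings \<mu> \<nu>" for \<rho>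
    unfolding pot[OF \<rho>, symmetric] using lip set_pmf_coupling_subset[OF \<rho>]
    by (intro integral_mono_AE integrable_measure_pmf_finite finc[OF \<rho>])
       (auto simp: AE_measure_pmf_iff)
  with \<pi> min show ?thesis
    unfolding wasserstein1_def by (intro cInf_eq_minimum) (auto intro!: image_eqI[of _ _ \<pi>])
qed

text \<open>The mass \<open>c\<close> common to both measures stays in place and the rest is coupled
  independently.\<close>

lemma coupling_fixing_common_mass:
  fixes \<mu> \<nu> :: "'a pmf" and c :: "'a \<Rightarrow> real"
  assumes fin: "finite A" and A: "set_pmf \<mu> \<subseteq> A" "set_pmf \<nu> \<subseteq> A"
    and c0: "\<And>z. 0 \<le> c z" and c\<mu>: "\<And>z. c z \<le> pmf \<mu> z" and c\<nu>: "\<And>z. c z \<le> pmf \<nu> z"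
    and c1: "sum c A < 1"
  obtains \<pi> where "\<pi> \<in> couplings \<mu> \<nu>"
    "\<And>p q. (p, q) \<in> set_pmf \<pi> \<Longrightarrow> p = q \<and> c p > 0 \<or> pmf \<mu> p > c p \<and> pmf \<nu> q > c q"
proof -
  define R where "R = 1 - sum c A"
  have R: "R > 0" using c1 by (simp add: R_def)
  \<comment> \<open>The product of the two residual measures, each of mass R, has marginals R times
    too large; dividing by R corrects this.\<close>
  define g where "g = (\<lambda>(p, q). (if p = q then c p else 0) + (pmf \<mu> p - c p) * (pmf \<nu> q - c q) / R)"
  have g0: "0 \<le> g z" for z
    using c0 c\<mu> c\<nu> R by (auto simp: g_def split: prod.split)
  have out: "c z = 0" "pmf \<mu> z = 0" "pmf \<nu> z = 0" if "z \<notin> A" for z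
  proof -
    show "pmf \<mu> z = 0" "pmf \<nu> z = 0" using that A by (auto simp: pmf_eq_0_set_pmf)
    then show "c z = 0" using c0[of z] c\<mu>[of z] by simp
  qed
  have sum\<mu>: "(\<Sum>p\<in>A. pmf \<mu> p - c p) = R" and sum\<nu>: "(\<Sum>q\<in>A. pmf \<nu> q - c q) = R"
    using sum_pmf_eq_1[OF fin A(1)] sum_pmf_eq_1[OF fin A(2)] by (simp_all add: sum_subtractf R_def)
  have row: "(\<Sum>q\<in>A. g (p, q)) = pmf \<mu> p" for p
  proof -
    have "(\<Sum>q\<in>A. g (p, q)) = (\<Sum>q\<in>A. if p = q then c p else 0) + (pmf \<mu> p - c p) * (\<Sum>q\<in>A. pmf \<nu> q - c q) / R"
      by (simp only: g_def prod.case sum.distrib sum_distrib_left sum_divide_distrib)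
    then show ?thesis using R fin out[of p] unfolding sum\<nu> by (auto simp: sum.delta')
  qed
  have col: "(\<Sum>p\<in>A. g (p, q)) = pmf \<nu> q" for q
  proof -
    have "(\<Sum>p\<in>A. g (p, q)) = (\<Sum>p\<in>A. if p = q then c p else 0) + (\<Sum>p\<in>A. pmf \<mu> p - c p) * (pmf \<nu> q - c q) / R"
      by (simp only: g_def prod.case sum.distrib sum_distrib_right sum_divide_distrib)
    then show ?thesis using R fin out[of q] unfolding sum\<mu> by (auto simp: sum.delta)
  qed
  have gout: "g z = 0" if "z \<notin> A \<times> A" for z
    using that out by (cases z) (auto simp: g_def)
  have "sum g (A \<times> A) = (\<Sum>p\<in>A. \<Sum>q\<in>A. g (p, q))" by (simp add: sum.cartesian_product)
  also have "\<dots> = 1" using sum_pmf_eq_1[OF fin A(1)] by (simp add: row)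
  finally have g1: "sum g (A \<times> A) = 1" .
  have "(\<integral>\<^sup>+ z. ennreal (g z) \<partial>count_space UNIV) = (\<Sum>z\<in>A \<times> A. ennreal (g z))"
    using gout fin by (intro nn_integral_count_space'[of "A \<times> A"]) auto
  also have "\<dots> = 1" using g1 g0 by (simp add: sum_ennreal)
  finally have "(\<integral>\<^sup>+ z. ennreal (g z) \<partial>count_space UNIV) = 1" .
  then have pmf_g: "pmf (embed_pmf g) z = g z" for z by (intro pmf_embed_pmf g0)
  have sup: "set_pmf (embed_pmf g) \<subseteq> A \<times> A"
    using gout by (metis pmf_g set_pmf_iff subsetI)
  have marg: "pmf (map_pmf h (embed_pmf g)) v = sum g {z \<in> A \<times> A. h z = v}" for h :: "'a \<times> 'a \<Rightarrow> 'a" and v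
  proof -
    have "pmf (map_pmf h (embed_pmf g)) v = measure_pmf.prob (embed_pmf g) {z \<in> A \<times> A. h z = v}"
      unfolding pmf_map using sup by (intro measure_pmf.finite_measure_eq_AE) (auto simp: AE_measure_pmf_iff)
    then show ?thesis using fin by (simp add: measure_measure_pmf_finite pmf_g)
  qed
  have "map_pmf fst (embed_pmf g) = \<mu>"
  proof (rule pmf_eqI)
    fix v
    show "pmf (map_pmf fst (embed_pmf g)) v = pmf \<mu> v"
    proof (cases "v \<in> A")
      case True
      then have "{z \<in> A \<times> A. fst z = v} = Pair v ` A" by auto
      then have "sum g {z \<in> A \<times> A. fst z = v} = (\<Sum>q\<in>A. g (v, q))"
        by (simp add: sum.reindex inj_on_def)
      then show ?thesis by (simp only: marg row)
    next
      case False
      then have "{z \<in> A \<times> A. fst z = v} = {}" by auto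
      then show ?thesis using out[OF False] by (simp only: marg sum.empty)
    qed
  qed
  moreover have "map_pmf snd (embed_pmf g) = \<nu>"
  proof (rule pmf_eqI)
    fix v
    show "pmf (map_pmf snd (embed_pmf g)) v = pmf \<nu> v"
    proof (cases "v \<in> A")
      case True
      then have "{z \<in> A \<times> A. snd z = v} = (\<lambda>p. (p, v)) ` A" by auto
      then have "sum g {z \<in> A \<times> A. snd z = v} = (\<Sum>p\<in>A. g (p, v))"
        by (simp add: sum.reindex inj_on_def)
      then show ?thesis by (simp only: marg col)
    next
      case False
      then have "{z \<in> A \<times> A. snd z = v} = {}" by auto
      then show ?thesis using out[OF False] by (simp only: marg sum.empty)
    qed
  qed
  ultimately have cpl: "embed_pmf g \<in> couplings \<mu> \<nu>" by (simp add: couplings_def)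
  have "p = q \<and> c p > 0 \<or> pmf \<mu> p > c p \<and> pmf \<nu> q > c q"
    if "(p, q) \<in> set_pmf (embed_pmf g)" for p q
  proof -
    have "g (p, q) \<noteq> 0" using that by (simp add: set_pmf_iff pmf_g)
    then show ?thesis using c0[of p] c\<mu>[of p] c\<nu>[of q]
      by (auto simp: g_def less_le split: if_splits)
  qed
  then show ?thesis by (rule that[OF cpl])
qed

section \<open>Graph distance, in general and in a tree\<close>

lemma gdist_le:
  assumes "walk V E p" "hd p = x" "last p = y" "length p = Suc n"
  shows "gdist V E x y \<le> n"
  unfolding gdist_def using assms by (intro Least_le exI[of _ p]) simp

lemma gdist_walk:
  assumes "connected_graph V E" "x \<in> V" "y \<in> V"
  obtains p where "walk V E p" "hd p = x" "last p = y" "length p = Suc (gdist V E x y)"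
proof -
  obtain p where "walk V E p" "hd p = x" "last p = y"
    using assms unfolding connected_graph_def by metis
  then have "\<exists>n p. walk V E p \<and> hd p = x \<and> last p = y \<and> length p = Suc n"
    by (intro exI[of _ "length p - 1"] exI[of _ p]) (auto simp: walk_def neq_Nil_conv)
  then have "\<exists>p. walk V E p \<and> hd p = x \<and> last p = y \<and> length p = Suc (gdist V E x y)"
    unfolding gdist_def by (rule LeastI_ex)
  with that show ?thesis by (elim exE conjE)
qed

lemma gdist_self:
  assumes "x \<in> V" shows "gdist V E x x = 0"
  using gdist_le[of V E "[x]" x x 0] assms by (simp add: walk_def)

lemma gdist_0:
  assumes "connected_graph V E" "x \<in> V" "y \<in> V" "gdist V E x y = 0"
  shows "x = y"
proof -
  obtain p where "walk V E p" "hd p = x" "last p = y" "length p = Suc (gdist V E x y)"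
    using gdist_walk[OF assms(1-3)] .
  with assms(4) show ?thesis by (auto simp: length_Suc_conv)
qed

lemma gdist_1:
  assumes "connected_graph V E" "x \<in> V" "y \<in> V" "gdist V E x y = 1"
  shows "{x, y} \<in> E"
proof -
  obtain p where "walk V E p" "hd p = x" "last p = y" "length p = Suc (gdist V E x y)"
    using gdist_walk[OF assms(1-3)] .
  with assms(4) show ?thesis by (auto simp: length_Suc_conv walk_def)
qed

lemma gdist_2:
  assumes "connected_graph V E" "x \<in> V" "y \<in> V" "gdist V E x y = 2"
  shows "\<exists>t. {x, t} \<in> E \<and> {t, y} \<in> E"
proof -
  obtain p where "walk V E p" "hd p = x" "last p = y" "length p = Suc (gdist V E x y)"
    using gdist_walk[OF assms(1-3)] .
  with assms(4) show ?thesis by (auto simp: length_Suc_conv walk_def numeral_2_eq_2)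
qed

context
  fixes V :: "'a set" and E :: "'a set set"
  assumes tree: "finite_tree V E"
begin

lemma tree_finite: "finite V" and tree_simple: "simple_graph V E" and tree_connected: "connected_graph V E"
  using tree by (simp_all add: finite_tree_def)

lemma tree_edgeD:
  assumes "{x, y} \<in> E" shows "x \<in> V" "y \<in> V" "x \<noteq> y"
  using assms tree_simple by (auto simp: simple_graph_def)

lemma tree_finite_nbrs: "finite (nbrs E x)"
  using tree_finite by (rule rev_finite_subset) (auto simp: nbrs_def dest: tree_edgeD)

lemma tree_no_cycle: "walk V E p \<Longrightarrow> distinct p \<Longrightarrow> 3 \<le> length p \<Longrightarrow> {last p, hd p} \<notin> E"
  using tree by (auto simp: finite_tree_def graph_cycle_def)

lemma tree_no_triangle: "{x, y} \<in> E \<Longrightarrow> {y, z} \<in> E \<Longrightarrow> {z, x} \<notin> E"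
  using tree_no_cycle[of "[x, y, z]"] tree_edgeD[of x y] tree_edgeD[of y z] tree_edgeD[of z x]
  by (auto simp: walk_def)

lemma tree_gdist_2:
  assumes "{x, y} \<in> E" "{y, z} \<in> E" "x \<noteq> z"
  shows "gdist V E x z = 2"
proof -
  note V = tree_edgeD[OF assms(1)] tree_edgeD[OF assms(2)]
  have "{x, z} \<notin> E" using tree_no_triangle[OF assms(1,2)] by (simp add: insert_commute)
  then have "gdist V E x z \<noteq> 0" "gdist V E x z \<noteq> 1"
    using gdist_0[OF tree_connected, of x z] gdist_1[OF tree_connected, of x z] V assms(3) by auto
  moreover have "gdist V E x z \<le> 2"
    using gdist_le[of V E "[x, y, z]" x z 2] assms V by (simp add: walk_def)
  ultimately show ?thesis by linarith
qed

lemma tree_gdist_1: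
  assumes "{x, y} \<in> E"
  shows "gdist V E x y = 1"
proof -
  note V = tree_edgeD[OF assms]
  have "gdist V E x y \<noteq> 0" using gdist_0[OF tree_connected, of x y] V by auto
  moreover have "gdist V E x y \<le> 1"
    using gdist_le[of V E "[x, y]" x y 1] assms V by (simp add: walk_def)
  ultimately show ?thesis by linarith
qed

text \<open>A smaller distance would close a cycle with the path z, x, y, u: a triangle for distance
  0, a 4-cycle for 1, a 5-cycle through the midpoint t for 2.\<close>

lemma tree_gdist_3:
  assumes xy: "{x, y} \<in> E" and z: "{z, x} \<in> E" "z \<noteq> y" and u: "{y, u} \<in> E" "u \<noteq> x"
  shows "gdist V E z u = 3"
proof -
  note V = tree_edgeD[OF xy] tree_edgeD[OF z(1)] tree_edgeD[OF u(1)]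
  have zy: "{z, y} \<notin> E" using tree_no_triangle[OF z(1) xy] by (simp add: insert_commute)
  have xu: "{x, u} \<notin> E" using tree_no_triangle[OF xy u(1)] by (simp add: insert_commute)
  have "z \<noteq> u" using zy u by (auto simp: insert_commute)
  have "gdist V E z u \<le> 3"
    using gdist_le[of V E "[z, x, y, u]" z u 3] xy z u V by (simp add: walk_def)
  moreover have "gdist V E z u \<noteq> 0"
    using gdist_0[OF tree_connected, of z u] V \<open>z \<noteq> u\<close> by auto
  moreover have "gdist V E z u \<noteq> 1"
  proof
    assume "gdist V E z u = 1"
    then have "{z, u} \<in> E" using gdist_1[OF tree_connected, of z u] V by simp
    then show False
      using tree_no_cycle[of "[z, x, y, u]"] xy z u V \<open>z \<noteq> u\<close> by (auto simp: walk_def insert_commute)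
  qed
  moreover have "gdist V E z u \<noteq> 2"
  proof
    assume "gdist V E z u = 2"
    then obtain t where t: "{z, t} \<in> E" "{t, u} \<in> E" using gdist_2[OF tree_connected, of z u] V by auto
    then have "t \<noteq> x" "t \<noteq> y" using xu zy by auto
    then show False
      using tree_no_cycle[of "[z, x, y, u, t]"] xy z u V t \<open>z \<noteq> u\<close> tree_edgeD[OF t(1)] tree_edgeD[OF t(2)]
      by (auto simp: walk_def insert_commute)
  qed
  ultimately show ?thesis by linarith
qed

section \<open>Curvature of a tree edge\<close>

text \<open>For \<alpha> > 1/2 the common mass is (1 - \<alpha>) b at x and (1 - \<alpha>) a at y,
  and it stays in place. The rest moves from x and its other neighbours to y and its other
  neighbours, always across xy, so every coupling of the rest is optimal.\<close>

lemma tree_wasserstein1_idle: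
  assumes xy: "{x, y} \<in> E" and w: "\<And>e. e \<in> E \<Longrightarrow> 0 < w e" and \<alpha>: "1 / 2 < \<alpha>" "\<alpha> < 1"
  defines "a \<equiv> w {x, y} / wdeg E w x" and "b \<equiv> w {x, y} / wdeg E w y"
  shows "wasserstein1 (\<lambda>u v. real (gdist V E u v)) (idle_pmf E w \<alpha> x) (idle_pmf E w \<alpha> y)
    = 1 - (1 - \<alpha>) * (2 * (a + b - 1))"
proof -
  define \<mu> where "\<mu> = idle_pmf E w \<alpha> x"
  define \<nu> where "\<nu> = idle_pmf E w \<alpha> y"
  note V = tree_edgeD[OF xy]
  have yx: "{y, x} \<in> E" using xy by (simp add: insert_commute)
  have ny: "y \<in> nbrs E x" and nx: "x \<in> nbrs E y" using xy yx by (simp_all add: nbrs_def)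
  have xn: "x \<notin> nbrs E x" "y \<notin> nbrs E y" using tree_edgeD(3)[of x x] tree_edgeD(3)[of y y] by (auto simp: nbrs_def)
  have pmf\<mu>: "pmf \<mu> z = (if z = x then \<alpha> else if {x, z} \<in> E then (1 - \<alpha>) * w {x, z} / wdeg E w x else 0)" for z
    unfolding \<mu>_def using \<alpha> w ny by (intro pmf_idle_pmf[OF tree_simple tree_finite_nbrs]) auto
  have pmf\<nu>: "pmf \<nu> z = (if z = y then \<alpha> else if {y, z} \<in> E then (1 - \<alpha>) * w {y, z} / wdeg E w y else 0)" for z
    unfolding \<nu>_def using \<alpha> w nx by (intro pmf_idle_pmf[OF tree_simple tree_finite_nbrs]) auto
  have wdeg: "wdeg E w v = w {v, v'} + (\<Sum>z\<in>nbrs E v - {v'}. w {v, z})"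
    and wdeg_le: "0 < w {v, v'}" "w {v, v'} \<le> wdeg E w v" if "{v, v'} \<in> E" for v v'
  proof -
    show 1: "wdeg E w v = w {v, v'} + (\<Sum>z\<in>nbrs E v - {v'}. w {v, z})"
      unfolding wdeg_def using that by (intro sum.remove tree_finite_nbrs) (simp add: nbrs_def)
    have "0 \<le> (\<Sum>z\<in>nbrs E v - {v'}. w {v, z})" by (intro sum_nonneg) (auto simp: nbrs_def intro: less_imp_le w)
    with 1 show "w {v, v'} \<le> wdeg E w v" by simp
    show "0 < w {v, v'}" using w that by simp
  qed
  have w_yx: "w {y, x} = w {x, y}" by (simp add: insert_commute)
  have ab: "0 < a" "a \<le> 1" "0 < b" "b \<le> 1"
    using wdeg_le[OF xy] wdeg_le[OF yx] unfolding a_def b_def w_yx by auto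
  have sum_a: "(\<Sum>z\<in>nbrs E x - {y}. w {x, z} / wdeg E w x) = 1 - a"
    using wdeg[OF xy] wdeg_le[OF xy] unfolding a_def sum_divide_distrib[symmetric] by (simp add: field_simps)
  have sum_b: "(\<Sum>z\<in>nbrs E y - {x}. w {y, z} / wdeg E w y) = 1 - b"
    using wdeg[OF yx] wdeg_le[OF yx] unfolding b_def sum_divide_distrib[symmetric] w_yx by (simp add: field_simps)
  have supp: "set_pmf \<mu> \<subseteq> insert x (nbrs E x)" "set_pmf \<nu> \<subseteq> insert y (nbrs E y)"
    by (auto simp: set_pmf_iff pmf\<mu> pmf\<nu> nbrs_def split: if_splits)
  \<comment> \<open>The position along the direction from x to y, with levels -1, 0, 1, 2. The
    default 2 is meant for neighbours of y; it is wrong for vertices behind a neighbour of x, but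
    these lie in neither support.\<close>
  define f :: "'a \<Rightarrow> real" where
    "f z = (if z = x then 0 else if z = y then 1 else if z \<in> nbrs E x then - 1 else 2)" for z
  have f: "f x = 0" "f y = 1" "\<And>z. z \<in> nbrs E x - {y} \<Longrightarrow> f z = - 1" "\<And>z. z \<in> nbrs E y - {x} \<Longrightarrow> f z = 2"
    using V xn tree_no_triangle[OF xy] tree_edgeD(3)[of x x] tree_edgeD(3)[of y y]
    by (auto simp: f_def nbrs_def insert_commute)
  have gd: "real (gdist V E p q) = f q - f p"
    if pq: "p \<in> insert x (nbrs E x - {y})" "q \<in> insert y (nbrs E y - {x})" for p q
  proof -
    consider "p = x" "q = y" | "p = x" "q \<in> nbrs E y - {x}" | "p \<in> nbrs E x - {y}" "q = y"
      | "p \<in> nbrs E x - {y}" "q \<in> nbrs E y - {x}" using pq by blast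
    then show ?thesis
    proof cases
      case 1
      then show ?thesis using f tree_gdist_1[OF xy] by simp
    next
      case 2
      then show ?thesis using f(1) f(4)[of q] tree_gdist_2[OF xy, of q] by (auto simp: nbrs_def)
    next
      case 3
      then show ?thesis using f(2) f(3)[of p] tree_gdist_2[of p x y] xy by (auto simp: nbrs_def insert_commute)
    next
      case 4
      then show ?thesis
        using f(3)[of p] f(4)[of q] tree_gdist_3[OF xy, of p q] by (auto simp: nbrs_def insert_commute)
    qed
  qed
  have lip: "f q - f p \<le> real (gdist V E p q)" if "p \<in> set_pmf \<mu>" "q \<in> set_pmf \<nu>" for p q
  proof -
    have p: "p \<in> insert x (insert y (nbrs E x - {y}))" and q: "q \<in> insert x (insert y (nbrs E y - {x}))"
      using that supp by auto
    consider "p = y" "q \<in> nbrs E y - {x}" | "p = y" "q \<in> {x, y}"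
      | "p = x" "q = x" | "p \<in> nbrs E x - {y}" "q = x"
      | "p \<in> insert x (nbrs E x - {y})" "q \<in> insert y (nbrs E y - {x})" using p q by blast
    then show ?thesis
    proof cases
      case 1
      then show ?thesis using f(2) f(4)[of q] tree_gdist_1[of p q] by (auto simp: nbrs_def)
    next
      case 4
      then show ?thesis using f(1) f(3)[of p] tree_gdist_1[of p q] by (auto simp: nbrs_def insert_commute)
    qed (use f gd in auto)
  qed
  \<comment> \<open>The pointwise minimum of \<mu> and \<nu>: at x and at y the idle mass is the
    larger of the two.\<close>
  define c where "c z = (if z = x then (1 - \<alpha>) * b else if z = y then (1 - \<alpha>) * a else 0)" for z
  have le: "(1 - \<alpha>) * a \<le> 1 - \<alpha>" "(1 - \<alpha>) * b \<le> 1 - \<alpha>"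
    using ab \<alpha> by (simp_all add: mult_left_le)
  then have small: "(1 - \<alpha>) * a < \<alpha>" "(1 - \<alpha>) * b < \<alpha>"
    using \<alpha> by linarith+
  have "pmf \<mu> x = \<alpha>" "pmf \<mu> y = (1 - \<alpha>) * a" "pmf \<nu> x = (1 - \<alpha>) * b" "pmf \<nu> y = \<alpha>"
    using xy yx V by (simp_all add: pmf\<mu> pmf\<nu> a_def b_def w_yx)
  then have c\<mu>: "c z \<le> pmf \<mu> z" and c\<nu>: "c z \<le> pmf \<nu> z" for z
    using small by (auto simp: c_def)
  define A where "A = insert x (nbrs E x) \<union> insert y (nbrs E y)"
  have finA: "finite A" by (simp add: A_def tree_finite_nbrs)
  have "sum c A = sum c {x, y}" using finA V by (intro sum.mono_neutral_right) (auto simp: A_def c_def)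
  also have "\<dots> = (1 - \<alpha>) * b + (1 - \<alpha>) * a" using V by (simp add: c_def)
  also have "\<dots> < 1" using le \<alpha> by linarith
  finally have c1: "sum c A < 1" .
  obtain \<pi> where \<pi>: "\<pi> \<in> couplings \<mu> \<nu>"
    and \<pi>_supp: "\<And>p q. (p, q) \<in> set_pmf \<pi> \<Longrightarrow> p = q \<and> c p > 0 \<or> pmf \<mu> p > c p \<and> pmf \<nu> q > c q"
    using coupling_fixing_common_mass[OF finA _ _ _ c\<mu> c\<nu> c1] supp ab \<alpha>
    unfolding A_def c_def by (smt (verit) Un_upper1 Un_upper2 mult_nonneg_nonneg order_trans)
  have tight: "real (gdist V E p q) = f q - f p" if "(p, q) \<in> set_pmf \<pi>" for p q
    using \<pi>_supp[OF that]
  proof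
    assume "p = q \<and> c p > 0"
    then show ?thesis using V by (auto simp: c_def gdist_self split: if_splits)
  next
    assume *: "pmf \<mu> p > c p \<and> pmf \<nu> q > c q"
    have "p \<in> insert x (nbrs E x)" "q \<in> insert y (nbrs E y)"
      using set_pmf_coupling_subset[OF \<pi>] that supp by auto
    \<comment> \<open>All mass of \<mu> at y and of \<nu> at x is common, so no residue starts at y
      or ends at x.\<close>
    moreover have "p \<noteq> y" "q \<noteq> x"
      using * V xy yx by (auto simp: c_def pmf\<mu> pmf\<nu> a_def b_def w_yx)
    ultimately show ?thesis by (intro gd) auto
  qed
  have "measure_pmf.expectation \<mu> f = (\<Sum>z\<in>insert x (nbrs E x). pmf \<mu> z * f z)"
    using supp tree_finite_nbrs by (subst integral_measure_pmf_real[of "insert x (nbrs E x)"]) (auto simp: mult.commute)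
  also have "\<dots> = (\<Sum>z\<in>nbrs E x. pmf \<mu> z * f z)"
    using xn tree_finite_nbrs by (simp add: f)
  also have "\<dots> = pmf \<mu> y * f y + (\<Sum>z\<in>nbrs E x - {y}. pmf \<mu> z * f z)"
    by (rule sum.remove[OF tree_finite_nbrs ny])
  also have "(\<Sum>z\<in>nbrs E x - {y}. pmf \<mu> z * f z) = (\<Sum>z\<in>nbrs E x - {y}. (\<alpha> - 1) * (w {x, z} / wdeg E w x))"
    using xn by (intro sum.cong refl) (auto simp: algebra_simps diff_divide_distrib f pmf\<mu> nbrs_def)
  also have "\<dots> = (\<alpha> - 1) * (1 - a)" unfolding sum_distrib_left[symmetric] sum_a ..
  also have "pmf \<mu> y * f y = (1 - \<alpha>) * a" using V xy by (simp add: pmf\<mu> f a_def)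
  finally have E\<mu>: "measure_pmf.expectation \<mu> f = (1 - \<alpha>) * a + (\<alpha> - 1) * (1 - a)" .
  have "measure_pmf.expectation \<nu> f = (\<Sum>z\<in>insert y (nbrs E y). pmf \<nu> z * f z)"
    using supp tree_finite_nbrs by (subst integral_measure_pmf_real[of "insert y (nbrs E y)"]) (auto simp: mult.commute)
  also have "\<dots> = \<alpha> + (\<Sum>z\<in>nbrs E y. pmf \<nu> z * f z)"
    using xn tree_finite_nbrs by (simp add: f pmf\<nu>)
  also have "(\<Sum>z\<in>nbrs E y. pmf \<nu> z * f z) = pmf \<nu> x * f x + (\<Sum>z\<in>nbrs E y - {x}. pmf \<nu> z * f z)"
    by (rule sum.remove[OF tree_finite_nbrs nx])
  also have "(\<Sum>z\<in>nbrs E y - {x}. pmf \<nu> z * f z) = (\<Sum>z\<in>nbrs E y - {x}. 2 * (1 - \<alpha>) * (w {y, z} / wdeg E w y))"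
    using xn by (intro sum.cong refl) (auto simp: f pmf\<nu> nbrs_def)
  also have "\<dots> = 2 * (1 - \<alpha>) * (1 - b)" unfolding sum_distrib_left[symmetric] sum_b ..
  finally have E\<nu>: "measure_pmf.expectation \<nu> f = \<alpha> + 2 * (1 - \<alpha>) * (1 - b)" by (simp add: f)
  have fin: "finite (set_pmf \<mu>)" "finite (set_pmf \<nu>)"
    using supp tree_finite_nbrs by (meson finite_insert finite_subset)+
  show ?thesis
    using wasserstein1_eqI[where f = f and d = "\<lambda>u v. real (gdist V E u v)", OF fin lip \<pi> tight]
    unfolding E\<mu> E\<nu>
    by (simp add: \<mu>_def \<nu>_def algebra_simps)
qed

text \<open>The quotient is constant for \<alpha> between 1/2 and 1, so the limit is attained rather
  than approached.\<close>

lemma tree_kappa_LLY: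
  assumes "{x, y} \<in> E" "\<And>e. e \<in> E \<Longrightarrow> 0 < w e"
  shows "kappa_LLY V E w x y = 2 * (w {x, y} / wdeg E w x + w {x, y} / wdeg E w y - 1)"
proof -
  let ?K = "2 * (w {x, y} / wdeg E w x + w {x, y} / wdeg E w y - 1)"
  have "eventually (\<lambda>\<alpha>. \<alpha> \<in> {1 / 2<..<1}) (at_left (1 :: real))"
    by (rule eventually_at_leftI[of "1 / 2"]) auto
  then have "eventually (\<lambda>\<alpha>. kappa V E w \<alpha> x y / (1 - \<alpha>) = ?K) (at_left 1)"
    by eventually_elim (use tree_wasserstein1_idle[OF assms] in \<open>simp add: kappa_def\<close>)
  then have "((\<lambda>\<alpha>. kappa V E w \<alpha> x y / (1 - \<alpha>)) \<longlongrightarrow> ?K) (at_left 1)"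
    by (rule tendsto_eventually)
  then show ?thesis unfolding kappa_LLY_def by (intro tendsto_Lim) auto
qed

lemma tree_admissible_curvature:
  assumes adm: "admissible V E w" and xy: "{x, y} \<in> E"
  shows "other_weight E w x y * other_weight E w y x \<le> (w {x, y})\<^sup>2"
proof -
  have w: "0 < w e" if "e \<in> E" for e using adm that by (simp add: admissible_def)
  define a where "a = w {x, y}"
  define S where "S = other_weight E w x y"
  define S' where "S' = other_weight E w y x"
  have dy: "wdeg E w y = a + S"
    unfolding a_def S_def by (rule wdeg_split[OF tree_finite_nbrs xy])
  have dx: "wdeg E w x = a + S'"
    using wdeg_split[OF tree_finite_nbrs, of y x] xy unfolding a_def S'_def by (simp add: insert_commute)
  have "0 \<le> S" "0 \<le> S'"
    unfolding S_def S'_def by (intro other_weight_nonneg less_imp_le w; assumption)+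
  moreover have "0 < a" unfolding a_def by (intro w xy)
  moreover have "0 \<le> kappa_LLY V E w x y" using adm xy by (simp add: admissible_def)
  then have "1 \<le> a / (a + S') + a / (a + S)"
    using tree_kappa_LLY[OF xy, of w] w by (simp add: dx dy flip: a_def)
  ultimately have "0 < a + S'" "0 < a + S" and *: "1 \<le> a / (a + S') + a / (a + S)" by simp_all
  then have "1 \<le> (a * (a + S) + a * (a + S')) / ((a + S') * (a + S))"
    by (subst (asm) add_frac_eq) simp_all
  then have "(a + S') * (a + S) \<le> a * (a + S) + a * (a + S')"
    using mult_pos_pos[OF \<open>0 < a + S'\<close> \<open>0 < a + S\<close>] by (simp only: le_divide_eq_1_pos)
  then have "S * S' \<le> a * a" by (simp add: algebra_simps)
  then show ?thesis by (simp add: a_def S_def S'_def power2_eq_square)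
qed

end

section \<open>From weights to distortion, and rounding up\<close>

lemma Dist_finite:
  assumes "e\<^sub>1 \<in> E" "e\<^sub>2 \<in> E" "0 < w e\<^sub>2" "\<And>e. e \<in> E \<Longrightarrow> w e \<le> w e\<^sub>1" "\<And>e. e \<in> E \<Longrightarrow> w e\<^sub>2 \<le> w e"
  shows "Dist E w = ereal (w e\<^sub>1 / w e\<^sub>2)"
proof -
  have "(SUP e\<in>E. ereal (w e)) = ereal (w e\<^sub>1)" "(INF e\<in>E. ereal (w e)) = ereal (w e\<^sub>2)"
    using assms by (auto intro!: SUP_eqI INF_eqI)
  then show ?thesis using assms(3) by (simp add: Dist_def)
qed

lemma tree_Dist_ge:
  assumes tree: "finite_tree V E" and "E \<noteq> {}" and adm: "admissible V E w"
  shows "ereal (card (branch_vertices V E) - 3 / 4) \<le> Dist E w"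
proof -
  have w: "0 < w e" if "e \<in> E" for e using adm that by (simp add: admissible_def)
  have "finite E"
    using tree_finite[OF tree] tree_simple[OF tree]
    by (intro finite_subset[of E "Pow V"]) (auto simp: simple_graph_def)
  then have img: "finite (w ` E)" "w ` E \<noteq> {}" using \<open>E \<noteq> {}\<close> by auto
  obtain e\<^sub>1 where e1: "e\<^sub>1 \<in> E" "w e\<^sub>1 = Max (w ` E)" using Max_in[OF img] by auto
  obtain e\<^sub>2 where e2: "e\<^sub>2 \<in> E" "w e\<^sub>2 = Min (w ` E)" using Min_in[OF img] by auto
  have max: "w e \<le> w e\<^sub>1" and min: "w e\<^sub>2 \<le> w e" if "e \<in> E" for e
    using that img by (simp_all add: e1 e2)
  obtain x y where xy: "e\<^sub>1 = {x, y}" "x \<in> V"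
    using e1(1) tree_simple[OF tree] by (auto simp: simple_graph_def card_2_iff)
  obtain k where "V \<subseteq> beyond E k x y \<union> beyond E k y x"
    using connected_cover[OF tree_finite[OF tree] tree_connected[OF tree] xy(2)] by blast
  then have cover: "branch_vertices V E \<subseteq> beyond E k x y \<union> beyond E k y x"
    by (auto simp: branch_vertices_def)
  have "card (branch_vertices V E) - 3 / 4 \<le> w e\<^sub>1 / w e\<^sub>2"
    using e1(1) max min
    by (intro branch_count_max_edge[OF tree_finite_nbrs[OF tree] w[OF e2(1)] _ _
        tree_admissible_curvature[OF tree adm] _ _ _ cover])
      (auto simp: xy branch_vertices_def)
  then show ?thesis using Dist_finite[OF e1(1) e2(1) w[OF e2(1)] max min] by simp
qed

lemma connected_graph_has_edge:
  assumes "connected_graph V E" "card V \<noteq> 1"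
  shows "E \<noteq> {}"
proof
  assume "E = {}"
  have "x = y" if "x \<in> V" "y \<in> V" for x y
  proof -
    have "\<exists>p. walk V {} p \<and> hd p = x \<and> last p = y"
      using assms(1) that \<open>E = {}\<close> by (simp add: connected_graph_def)
    then obtain p where p: "walk V {} p" "hd p = x" "last p = y" by (elim exE conjE)
    then obtain v q where "p = v # q" by (auto simp: walk_def neq_Nil_conv)
    with p show ?thesis by (cases q) (simp_all add: walk_def)
  qed
  moreover obtain v where "v \<in> V" using assms(1) by (auto simp: connected_graph_def)
  ultimately have "V = {v}" by auto
  then show False using assms(2) by simp
qed

text \<open>A real number r \<ge> n - 3/4 exceeds n - 1, so its ceiling is at least n; the value
  \<infinity> is kept by \<open>ereal_ceiling\<close>.\<close>

lemma le_ereal_ceiling: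
  assumes "ereal (real n - 3 / 4) \<le> x"
  shows "ereal (real n) \<le> ereal_ceiling x"
proof (cases x)
  case (real r)
  then have "int n \<le> \<lceil>r\<rceil>" using assms by (simp add: le_ceiling_iff)
  then show ?thesis using real by (simp add: ereal_ceiling_def)
qed (use assms in \<open>auto simp: ereal_ceiling_def\<close>)

theorem theorem1p5:
  fixes V :: "'a set" and E :: "'a set set"
  assumes "finite_tree V E"
  shows "ereal (real (card (branch_vertices V E))) \<le> ereal_ceiling (DN_LLY V E)"
proof (cases "card V = 1")
  case True
  have "card (branch_vertices V E) \<le> card V"
    using tree_finite[OF assms] by (intro card_mono) (auto simp: branch_vertices_def)
  then show ?thesis using True by (simp add: DN_LLY_def ereal_ceiling_def)
next
  case False
  then have "E \<noteq> {}" using connected_graph_has_edge tree_connected[OF assms] by blast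
  then have "ereal (card (branch_vertices V E) - 3 / 4) \<le> DN_LLY V E"
    unfolding DN_LLY_def using False tree_Dist_ge[OF assms] by (auto intro!: INF_greatest)
  then show ?thesis by (rule le_ereal_ceiling)
qed

end
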